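(* Let $d\ge 2$ be a fixed integer, let $Q$ be any non-degenerate quadratic form on $\mathbb{F}_q^d$, and let $\mathcal{E} \subset \mathbb{F}_q^d$. Suppose that $|\mathcal{E}| \gg q^{(d+1)/2}$. Then there exists a subset $\mathcal{E}' \subset \mathcal{E}$ with cardinality $|\mathcal{E}'| = (1-o(1))|\mathcal{E}|$ such that for every $\boldsymbol{y} \in \mathcal{E}'$ one has $|\Delta^Q_{\boldsymbol{y}}(\mathcal{E})| = (1-o(1))q$.
   Context: $q$ is a power of an odd prime, viewed as an asymptotic parameter: $q\to\infty$, the set $\mathcal{E}$ and the form $Q$ may depend on $q$, and $o(1)$ denotes a quantity tending to $0$ as $q\to\infty$ (uniformly in $\boldsymbol{y}\in\mathcal{E}'$). $X \ll Y$ (equivalently $Y \gg X$) means $X = o(Y)$. The pinned distance set is $\Delta^Q_{\boldsymbol{y}}(\mathcal{E}) = \{Q(\boldsymbol{x}-\boldsymbol{y}) : \boldsymbol{x}\in\mathcal{E}\}\subset\mathbb{F}_q$. *)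

theory Defs
  imports Complex_Main "HOL-Library.FuncSet" "HOL-Library.Landau_Symbols"
    "HOL-Computational_Algebra.Primes" "HOL-Algebra.Ring"
begin

text \<open>
  Finite fields are rendered as records of \<open>HOL-Algebra\<close>, rather than by type classes, because
  the asymptotic statement needs the field to vary along a sequence. Vectors of \<open>R\<^sup>d\<close> are
  extensional functions on \<open>{..<d}\<close>, so that equality of vectors is equality of functions.
\<close>

definition vecs :: "('a, 'm) ring_scheme \<Rightarrow> nat \<Rightarrow> (nat \<Rightarrow> 'a) set" where
  "vecs R d = {..<d} \<rightarrow>\<^sub>E carrier R"

definition vec_zero :: "('a, 'm) ring_scheme \<Rightarrow> nat \<Rightarrow> (nat \<Rightarrow> 'a)" where
  "vec_zero R d = (\<lambda>i\<in>{..<d}. \<zero>\<^bsub>R\<^esub>)"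

definition vec_add :: "('a, 'm) ring_scheme \<Rightarrow> nat \<Rightarrow> (nat \<Rightarrow> 'a) \<Rightarrow> (nat \<Rightarrow> 'a) \<Rightarrow> (nat \<Rightarrow> 'a)" where
  "vec_add R d x y = (\<lambda>i\<in>{..<d}. x i \<oplus>\<^bsub>R\<^esub> y i)"

definition vec_diff :: "('a, 'm) ring_scheme \<Rightarrow> nat \<Rightarrow> (nat \<Rightarrow> 'a) \<Rightarrow> (nat \<Rightarrow> 'a) \<Rightarrow> (nat \<Rightarrow> 'a)" where
  "vec_diff R d x y = (\<lambda>i\<in>{..<d}. x i \<ominus>\<^bsub>R\<^esub> y i)"

text \<open>
  Values of \<open>Q\<close> outside \<open>vecs R d\<close> are irrelevant. The coefficient matrix \<open>A\<close> need not be
  symmetric.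
\<close>

definition quadratic_form ::
    "('a, 'm) ring_scheme \<Rightarrow> nat \<Rightarrow> ((nat \<Rightarrow> 'a) \<Rightarrow> 'a) \<Rightarrow> bool" where
  "quadratic_form R d Q \<longleftrightarrow>
     (\<exists>A. (\<forall>i<d. \<forall>j<d. A i j \<in> carrier R) \<and>
          (\<forall>x\<in>vecs R d.
             Q x = (\<Oplus>\<^bsub>R\<^esub>i\<in>{..<d}. \<Oplus>\<^bsub>R\<^esub>j\<in>{..<d}. A i j \<otimes>\<^bsub>R\<^esub> x i \<otimes>\<^bsub>R\<^esub> x j)))"

definition polar_form ::
    "('a, 'm) ring_scheme \<Rightarrow> nat \<Rightarrow> ((nat \<Rightarrow> 'a) \<Rightarrow> 'a) \<Rightarrow> (nat \<Rightarrow> 'a) \<Rightarrow> (nat \<Rightarrow> 'a) \<Rightarrow> 'a" where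
  "polar_form R d Q x y = Q (vec_add R d x y) \<ominus>\<^bsub>R\<^esub> Q x \<ominus>\<^bsub>R\<^esub> Q y"

text \<open>
  The polar form is twice the symmetric bilinear form of \<open>Q\<close>; in odd characteristic
  the two have the same radical.
\<close>

definition nondegenerate_quadratic_form ::
    "('a, 'm) ring_scheme \<Rightarrow> nat \<Rightarrow> ((nat \<Rightarrow> 'a) \<Rightarrow> 'a) \<Rightarrow> bool" where
  "nondegenerate_quadratic_form R d Q \<longleftrightarrow>
     quadratic_form R d Q \<and>
     (\<forall>x\<in>vecs R d. (\<forall>y\<in>vecs R d. polar_form R d Q x y = \<zero>\<^bsub>R\<^esub>) \<longrightarrow> x = vec_zero R d)"

definition pinned_distance_set ::
    "('a, 'm) ring_scheme \<Rightarrow> nat \<Rightarrow> ((nat \<Rightarrow> 'a) \<Rightarrow> 'a) \<Rightarrow> (nat \<Rightarrow> 'a) set \<Rightarrow> (nat \<Rightarrow> 'a) \<Rightarrow> 'a set" where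
  "pinned_distance_set R d Q E y = {Q (vec_diff R d x y) | x. x \<in> E}"

end

theory Submission imports Defs begin

text \<open>
  The proof is a second moment argument in which the pin \<open>y\<close> is averaged over the whole space
  rather than over \<open>E\<close>. Fix one field of order \<open>q\<close> and put \<open>m = |E|\<close>. For a pin \<open>y\<close>, let
  \<open>\<nu>\<^sub>y(t)\<close> be the number of points of \<open>E\<close> at distance \<open>t\<close> from \<open>y\<close>. The mean of \<open>\<nu>\<^sub>y\<close> over the
  field is \<open>m/q\<close>, and every missing distance contributes \<open>(m/q)\<^sup>2\<close> to the sum of the squared
  deviations from this mean. Few distances are therefore missing if \<open>\<Sum>\<^sub>t \<nu>\<^sub>y(t)\<^sup>2\<close>, the number
  of pairs of points of \<open>E\<close> equidistant from \<open>y\<close>, is close to \<open>m\<^sup>2/q\<close>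
  (\<open>missing_values_le\<close>).

  Summed over all \<open>y\<close> in the space, the number of such pairs is easy to bound. For distinct points
  \<open>x\<close> and \<open>x'\<close> the quadratic terms in \<open>y\<close> cancel from the equation \<open>Q(x - y) = Q(x' - y)\<close>,
  which becomes linear in \<open>y\<close> with the coefficient functional given by the polar form at
  \<open>x - x'\<close>. This functional is nonzero because \<open>Q\<close> is nondegenerate, so at most \<open>q\<^sup>d\<^sup>-\<^sup>1\<close> pins
  are equidistant from \<open>x\<close> and \<open>x'\<close> (\<open>card_equidistant_le\<close>). Off-diagonal pairs thus contribute
  no more than the main term \<open>m\<^sup>2 q\<^sup>d\<^sup>-\<^sup>1\<close>, and only the \<open>m\<close> diagonal pairs, each counted
  \<open>q\<^sup>d\<close> times, remain as an error. The total number of missing distances over all pins is then at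
  most \<open>q\<^sup>d\<^sup>+\<^sup>2/m\<close> (\<open>sum_missing_distances_le\<close>).

  All terms of that total are nonnegative, so it also bounds the sum over pins in \<open>E\<close>. With
  \<open>\<delta> = q\<^bsup>(d+1)/2\<^esup>/m\<close> the bound reads \<open>\<delta>\<^sup>2 q m\<close>, and by Markov's inequality at most \<open>\<delta> m\<close>
  pins in \<open>E\<close> miss more than \<open>\<delta> q\<close> distances (\<open>card_bad_pins_le\<close>). The size hypothesis says
  precisely that \<open>\<delta>\<close> tends to zero.
\<close>

section \<open>Quadratic forms as diagonals of bilinear forms\<close>

text \<open>
  One operation that serves as sum (\<open>s = 1\<close>), as difference (\<open>s = -1\<close>) and as motion along a
  line in direction \<open>u\<close>, so that each linearity law is needed only once.
\<close>

definition vec_shift ::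
    "('a, 'm) ring_scheme \<Rightarrow> nat \<Rightarrow> (nat \<Rightarrow> 'a) \<Rightarrow> 'a \<Rightarrow> (nat \<Rightarrow> 'a) \<Rightarrow> (nat \<Rightarrow> 'a)" where
  "vec_shift R d x s u = (\<lambda>i\<in>{..<d}. x i \<oplus>\<^bsub>R\<^esub> s \<otimes>\<^bsub>R\<^esub> u i)"

definition bilinear_form ::
    "('a, 'm) ring_scheme \<Rightarrow> nat \<Rightarrow> (nat \<Rightarrow> nat \<Rightarrow> 'a) \<Rightarrow> (nat \<Rightarrow> 'a) \<Rightarrow> (nat \<Rightarrow> 'a) \<Rightarrow> 'a" where
  "bilinear_form R d A x y =
     (\<Oplus>\<^bsub>R\<^esub>i\<in>{..<d}. \<Oplus>\<^bsub>R\<^esub>j\<in>{..<d}. A i j \<otimes>\<^bsub>R\<^esub> x i \<otimes>\<^bsub>R\<^esub> y j)"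

context cring
begin

lemma vecs_nth [simp]: "x \<in> vecs R d \<Longrightarrow> i < d \<Longrightarrow> x i \<in> carrier R"
  by (auto simp: vecs_def)

lemma vec_shift_in_vecs [simp]:
  "x \<in> vecs R d \<Longrightarrow> s \<in> carrier R \<Longrightarrow> u \<in> vecs R d \<Longrightarrow> vec_shift R d x s u \<in> vecs R d"
  by (auto simp: vecs_def vec_shift_def)

lemma vec_add_eq_shift:
  "x \<in> vecs R d \<Longrightarrow> y \<in> vecs R d \<Longrightarrow> vec_add R d x y = vec_shift R d x \<one> y"
  by (auto simp: vec_add_def vec_shift_def fun_eq_iff)

lemma vec_diff_eq_shift:
  "x \<in> vecs R d \<Longrightarrow> y \<in> vecs R d \<Longrightarrow> vec_diff R d x y = vec_shift R d x (\<ominus> \<one>) y"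
  by (auto simp: vec_diff_def vec_shift_def fun_eq_iff minus_eq l_minus)

lemma vec_diff_in_vecs [simp]:
  "x \<in> vecs R d \<Longrightarrow> y \<in> vecs R d \<Longrightarrow> vec_diff R d x y \<in> vecs R d"
  by (simp add: vec_diff_eq_shift)

lemma vec_diff_eq_zeroD:
  assumes "x \<in> vecs R d" "y \<in> vecs R d" "vec_diff R d x y = vec_zero R d"
  shows "x = y"
proof -
  have "x i = y i" if "i < d" for i
  proof -
    have xy: "x i \<in> carrier R" "y i \<in> carrier R" "x i \<ominus> y i = \<zero>"
      using fun_cong[OF assms(3), of i] assms(1,2) that
      by (simp_all add: vec_diff_def vec_zero_def)
    have "x i = (x i \<ominus> y i) \<oplus> y i"
      using xy(1,2) by algebra
    with xy show ?thesis by simp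
  qed
  then show ?thesis
    using assms(1,2) unfolding vecs_def by (metis PiE_ext lessThan_iff)
qed

lemma bilinear_form_closed [simp]:
  assumes "\<forall>i<d. \<forall>j<d. A i j \<in> carrier R" "x \<in> vecs R d" "y \<in> vecs R d"
  shows "bilinear_form R d A x y \<in> carrier R"
  using assms by (auto simp: bilinear_form_def intro!: finsum_closed)

lemma finsum_shift:
  assumes "finite I" "f \<in> I \<rightarrow> carrier R" "g \<in> I \<rightarrow> carrier R" "s \<in> carrier R"
  shows "(\<Oplus>i\<in>I. f i \<oplus> s \<otimes> g i) = finsum R f I \<oplus> s \<otimes> finsum R g I"
proof -
  have "(\<Oplus>i\<in>I. f i \<oplus> s \<otimes> g i) = finsum R f I \<oplus> (\<Oplus>i\<in>I. s \<otimes> g i)"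
    using assms by (intro finsum_addf) auto
  then show ?thesis
    using assms by (simp add: finsum_rdistr)
qed

lemma bilinear_form_shift_right:
  assumes A: "\<forall>i<d. \<forall>j<d. A i j \<in> carrier R"
    and v: "x \<in> vecs R d" "y \<in> vecs R d" "u \<in> vecs R d" "s \<in> carrier R"
  shows "bilinear_form R d A x (vec_shift R d y s u) =
         bilinear_form R d A x y \<oplus> s \<otimes> bilinear_form R d A x u"
proof -
  have "bilinear_form R d A x (vec_shift R d y s u) =
    (\<Oplus>i\<in>{..<d}. \<Oplus>j\<in>{..<d}. A i j \<otimes> x i \<otimes> y j \<oplus> s \<otimes> (A i j \<otimes> x i \<otimes> u j))"
    unfolding bilinear_form_def
    using A v by (intro finsum_cong' refl finsum_closed Pi_I) 
      (auto intro!: finsum_closed simp: vec_shift_def r_distr m_assoc m_lcomm)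
  also have "\<dots> = (\<Oplus>i\<in>{..<d}. (\<Oplus>j\<in>{..<d}. A i j \<otimes> x i \<otimes> y j) \<oplus>
                     s \<otimes> (\<Oplus>j\<in>{..<d}. A i j \<otimes> x i \<otimes> u j))"
    using A v by (intro finsum_cong' refl finsum_shift) (auto intro!: finsum_closed)
  also have "\<dots> = bilinear_form R d A x y \<oplus> s \<otimes> bilinear_form R d A x u"
    unfolding bilinear_form_def
    using A v by (intro finsum_shift) (auto intro!: finsum_closed)
  finally show ?thesis .
qed

lemma bilinear_form_shift_left:
  assumes A: "\<forall>i<d. \<forall>j<d. A i j \<in> carrier R"
    and v: "x \<in> vecs R d" "y \<in> vecs R d" "u \<in> vecs R d" "s \<in> carrier R"
  shows "bilinear_form R d A (vec_shift R d y s u) x =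
         bilinear_form R d A y x \<oplus> s \<otimes> bilinear_form R d A u x"
proof -
  have "bilinear_form R d A (vec_shift R d y s u) x =
    (\<Oplus>i\<in>{..<d}. \<Oplus>j\<in>{..<d}. A i j \<otimes> y i \<otimes> x j \<oplus> s \<otimes> (A i j \<otimes> u i \<otimes> x j))"
    unfolding bilinear_form_def
    using A v by (intro finsum_cong' refl finsum_closed Pi_I) 
      (auto intro!: finsum_closed simp: vec_shift_def r_distr l_distr m_assoc m_lcomm)
  also have "\<dots> = (\<Oplus>i\<in>{..<d}. (\<Oplus>j\<in>{..<d}. A i j \<otimes> y i \<otimes> x j) \<oplus>
                     s \<otimes> (\<Oplus>j\<in>{..<d}. A i j \<otimes> u i \<otimes> x j))"
    using A v by (intro finsum_cong' refl finsum_shift) (auto intro!: finsum_closed)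
  also have "\<dots> = bilinear_form R d A y x \<oplus> s \<otimes> bilinear_form R d A u x"
    unfolding bilinear_form_def
    using A v by (intro finsum_shift) (auto intro!: finsum_closed)
  finally show ?thesis .
qed

lemma quadratic_formE:
  assumes "quadratic_form R d Q"
  obtains A where "\<forall>i<d. \<forall>j<d. A i j \<in> carrier R"
    and "\<And>x. x \<in> vecs R d \<Longrightarrow> Q x = bilinear_form R d A x x"
  using assms unfolding quadratic_form_def bilinear_form_def by blast

lemma quadratic_form_closed:
  "quadratic_form R d Q \<Longrightarrow> x \<in> vecs R d \<Longrightarrow> Q x \<in> carrier R"
  by (elim quadratic_formE) simp

lemma pinned_distance_set_subset:
  assumes "quadratic_form R d Q" "E \<subseteq> vecs R d" "y \<in> vecs R d"
  shows "pinned_distance_set R d Q E y \<subseteq> carrier R"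
proof -
  have "Q (vec_diff R d x y) \<in> carrier R" if "x \<in> E" for x
    using quadratic_form_closed[OF assms(1)] that assms(2,3) by auto
  then show ?thesis by (auto simp: pinned_distance_set_def)
qed

lemma polar_form_eq_bilinear:
  assumes A: "\<forall>i<d. \<forall>j<d. A i j \<in> carrier R"
    and Q: "\<And>x. x \<in> vecs R d \<Longrightarrow> Q x = bilinear_form R d A x x"
    and v: "x \<in> vecs R d" "y \<in> vecs R d"
  shows "polar_form R d Q x y = bilinear_form R d A x y \<oplus> bilinear_form R d A y x"
proof -
  have *: "(a \<oplus> c \<oplus> (b \<oplus> e)) \<ominus> a \<ominus> e = c \<oplus> b"
    if "a \<in> carrier R" "b \<in> carrier R" "c \<in> carrier R" "e \<in> carrier R" for a b c e
    using that by algebra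
  show ?thesis
    using A v
    by (simp add: polar_form_def vec_add_eq_shift Q bilinear_form_shift_left
        bilinear_form_shift_right * a_comm)
qed

lemma polar_form_closed:
  assumes "quadratic_form R d Q" "x \<in> vecs R d" "y \<in> vecs R d"
  shows "polar_form R d Q x y \<in> carrier R"
  using assms by (elim quadratic_formE) (simp add: polar_form_eq_bilinear)

lemma polar_form_shift:
  assumes "quadratic_form R d Q"
    and v: "x \<in> vecs R d" "y \<in> vecs R d" "u \<in> vecs R d" "s \<in> carrier R"
  shows "polar_form R d Q x (vec_shift R d y s u) =
         polar_form R d Q x y \<oplus> s \<otimes> polar_form R d Q x u"
proof -
  obtain A where A: "\<forall>i<d. \<forall>j<d. A i j \<in> carrier R"
    and Q: "\<And>x. x \<in> vecs R d \<Longrightarrow> Q x = bilinear_form R d A x x"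
    using assms(1) by (rule quadratic_formE) blast
  have *: "a \<oplus> s \<otimes> b \<oplus> (c \<oplus> s \<otimes> e) = a \<oplus> c \<oplus> s \<otimes> (b \<oplus> e)"
    if "a \<in> carrier R" "b \<in> carrier R" "c \<in> carrier R" "e \<in> carrier R" for a b c e
    using that v(4) by algebra
  show ?thesis
    using A v by (simp add: polar_form_eq_bilinear[OF A Q] bilinear_form_shift_left
        bilinear_form_shift_right *)
qed

text \<open>
  Both sides of the equidistance equation contain the same term \<open>Q(y)\<close>. After it cancels, only
  terms constant or linear in \<open>y\<close> are left, and \<open>y\<close> lies on a hyperplane with normal \<open>x - x'\<close>
  with respect to the polar form.
\<close>

lemma equidistant_imp_hyperplane:
  assumes "quadratic_form R d Q"
    and v: "x \<in> vecs R d" "x' \<in> vecs R d" "y \<in> vecs R d"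
    and eq: "Q (vec_diff R d x y) = Q (vec_diff R d x' y)"
  shows "polar_form R d Q (vec_diff R d x x') y = Q x \<ominus> Q x'"
proof -
  obtain A where A: "\<forall>i<d. \<forall>j<d. A i j \<in> carrier R"
    and Q: "\<And>x. x \<in> vecs R d \<Longrightarrow> Q x = bilinear_form R d A x x"
    using assms(1) by (rule quadratic_formE) blast
  let ?b = "bilinear_form R d A"
  have expand: "Q (vec_diff R d z y) = ?b z z \<oplus> \<ominus> ?b y z \<oplus> \<ominus> (?b z y \<oplus> \<ominus> ?b y y)"
    if "z \<in> vecs R d" for z
    using A that v(3)
    by (simp add: vec_diff_eq_shift Q bilinear_form_shift_left bilinear_form_shift_right l_minus)
  \<comment> \<open>Here \<open>a, b, c, e\<close> stand for \<open>b(x,y), b(y,x), b(y,y), b(x,x)\<close>, primed for \<open>x'\<close>.\<close>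
  have *: "a \<oplus> \<ominus> a' \<oplus> (b \<oplus> \<ominus> b') = e \<ominus> e'"
    if "e \<oplus> \<ominus> b \<oplus> \<ominus> (a \<oplus> \<ominus> c) = e' \<oplus> \<ominus> b' \<oplus> \<ominus> (a' \<oplus> \<ominus> c)"
      and c: "a \<in> carrier R" "b \<in> carrier R" "c \<in> carrier R" "e \<in> carrier R"
      "a' \<in> carrier R" "b' \<in> carrier R" "e' \<in> carrier R" for a b c e a' b' e'
  proof -
    have "e \<ominus> e' = (e \<oplus> \<ominus> b \<oplus> \<ominus> (a \<oplus> \<ominus> c)) \<ominus> e' \<oplus> b \<oplus> a \<ominus> c"
      using c by algebra
    also have "\<dots> = a \<oplus> \<ominus> a' \<oplus> (b \<oplus> \<ominus> b')"
      unfolding that(1) using c by algebra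
    finally show ?thesis by simp
  qed
  have "polar_form R d Q (vec_diff R d x x') y = 
      ?b x y \<oplus> \<ominus> ?b x' y \<oplus> (?b y x \<oplus> \<ominus> ?b y x')"
    using A v by (simp add: polar_form_eq_bilinear[OF A Q] vec_diff_eq_shift
      bilinear_form_shift_left bilinear_form_shift_right l_minus)
  also have "\<dots> = Q x \<ominus> Q x'"
    using eq A v unfolding expand[OF v(1)] expand[OF v(2)] 
    by (simp add: Q[OF v(1)] Q[OF v(2)]) (rule *, auto)
  finally show ?thesis .
qed

end

section \<open>Counting equidistant pins\<close>

context field
begin

text \<open>
  The lines with direction \<open>u\<close> are transversal to the hyperplane, hence its translates by the
  multiples of \<open>u\<close> are pairwise disjoint: the polar form recovers \<open>s\<close> from \<open>y + s u\<close>. This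
  yields the upper bound \<open>q\<^sup>d\<^sup>-\<^sup>1\<close> without any dimension theory.
\<close>

lemma card_polar_hyperplane_le:
  assumes Q: "quadratic_form R d Q" and fin: "finite (carrier R)"
    and z: "z \<in> vecs R d" and u: "u \<in> vecs R d" and nz: "polar_form R d Q z u \<noteq> \<zero>"
  shows "card {y \<in> vecs R d. polar_form R d Q z y = c} * card (carrier R) \<le> card (vecs R d)"
proof -
  let ?H = "{y \<in> vecs R d. polar_form R d Q z y = c}"
  let ?f = "\<lambda>(y, s). vec_shift R d y s u"
  have finv: "finite (vecs R d)"
    using fin by (auto simp: vecs_def intro: finite_PiE)
  have "inj_on ?f (?H \<times> carrier R)"
  proof (intro inj_onI, clarsimp)
    fix y y' s s'
    assume y: "y \<in> vecs R d" "c = polar_form R d Q z y" and y': "y' \<in> vecs R d"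
      "polar_form R d Q z y' = polar_form R d Q z y"
      and s: "s \<in> carrier R" "s' \<in> carrier R"
      and eq: "vec_shift R d y s u = vec_shift R d y' s' u"
    have "polar_form R d Q z y \<oplus> s \<otimes> polar_form R d Q z u =
          polar_form R d Q z y \<oplus> s' \<otimes> polar_form R d Q z u"
      using arg_cong[OF eq, of "polar_form R d Q z"] y y' s z u
      by (simp add: polar_form_shift[OF Q])
    then have ss: "s = s'"
      using s nz y z u polar_form_closed[OF Q] m_rcancel by simp
    have "y i = y' i" if "i < d" for i
      using fun_cong[OF eq, of i] that y y' s u ss by (simp add: vec_shift_def)
    then have "y = y'"
      using y(1) y'(1) unfolding vecs_def by (metis PiE_ext lessThan_iff)
    with ss show "y = y' \<and> s = s'" by simp
  qed
  moreover have "?f ` (?H \<times> carrier R) \<subseteq> vecs R d"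
    using u by auto
  ultimately have "card (?H \<times> carrier R) \<le> card (vecs R d)"
    using finv by (rule card_inj_on_le)
  then show ?thesis by (simp add: card_cartesian_product)
qed

lemma card_equidistant_le:
  assumes Q: "nondegenerate_quadratic_form R d Q" and fin: "finite (carrier R)"
    and x: "x \<in> vecs R d" "x' \<in> vecs R d" "x \<noteq> x'"
  shows "card {y \<in> vecs R d. Q (vec_diff R d x y) = Q (vec_diff R d x' y)} * card (carrier R)
         \<le> card (vecs R d)"
proof -
  have qf: "quadratic_form R d Q"
    using Q by (simp add: nondegenerate_quadratic_form_def)
  have finv: "finite (vecs R d)"
    using fin by (auto simp: vecs_def intro: finite_PiE)
  obtain u where u: "u \<in> vecs R d" "polar_form R d Q (vec_diff R d x x') u \<noteq> \<zero>"
    using Q x vec_diff_eq_zeroD[OF x(1,2)] vec_diff_in_vecs[OF x(1,2)]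
    unfolding nondegenerate_quadratic_form_def by blast
  have "card {y \<in> vecs R d. Q (vec_diff R d x y) = Q (vec_diff R d x' y)}
        \<le> card {y \<in> vecs R d. polar_form R d Q (vec_diff R d x x') y = Q x \<ominus> Q x'}"
    using finv equidistant_imp_hyperplane[OF qf] x by (intro card_mono) auto
  then have "card {y \<in> vecs R d. Q (vec_diff R d x y) = Q (vec_diff R d x' y)} * card (carrier R)
        \<le> card {y \<in> vecs R d. polar_form R d Q (vec_diff R d x x') y = Q x \<ominus> Q x'} * card (carrier R)"
    by simp
  also have "\<dots> \<le> card (vecs R d)"
    using card_polar_hyperplane_le[OF qf fin _ u] x by simp
  finally show ?thesis .
qed

end

section \<open>The second moment of the distance counts\<close>

text \<open>
  With \<open>n t\<close> the size of the fibre over \<open>t\<close>, the right-hand side is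
  \<open>\<Sum>\<^sub>t (|F| n t - |E|)\<^sup>2\<close>, the variance of the fibre sizes cleared of denominators. Each value
  outside the image has \<open>n t = 0\<close> and contributes \<open>|E|\<^sup>2\<close>; the left-hand side keeps only these
  terms.
\<close>

lemma missing_values_le:
  fixes f :: "'b \<Rightarrow> 'c"
  assumes E: "finite E" and F: "finite F" "F \<noteq> {}" and f: "f ` E \<subseteq> F"
  shows "(real (card F) - real (card (f ` E))) * (real (card E))\<^sup>2
         \<le> (real (card F))\<^sup>2 * real (card {(x, x') \<in> E \<times> E. f x = f x'})
           - real (card F) * (real (card E))\<^sup>2"
proof -
  define n where "n t = real (card {x \<in> E. f x = t})" for t
  define q where "q = real (card F)"
  define m where "m = real (card E)"
  have q: "q > 0" using F by (simp add: q_def card_gt_0_iff)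
  have sum1: "(\<Sum>t\<in>F. n t) = m"
  proof -
    have "(\<Sum>t\<in>F. card {x \<in> E. f x = t}) = card E"
      using sum.group[OF E F(1) f, of "\<lambda>_. 1::nat"] by simp
    then show ?thesis unfolding n_def m_def by (metis of_nat_sum)
  qed
  have sum2: "(\<Sum>t\<in>F. (n t)\<^sup>2) = real (card {(x, x') \<in> E \<times> E. f x = f x'})"
  proof -
    have "{(x, x') \<in> E \<times> E. f x = f x'} = (\<Union>t\<in>F. {x \<in> E. f x = t} \<times> {x \<in> E. f x = t})"
      using f by auto
    also have "card \<dots> = (\<Sum>t\<in>F. card ({x \<in> E. f x = t} \<times> {x \<in> E. f x = t}))"
      using E F(1) by (intro card_UN_disjoint) auto
    finally show ?thesis
      by (simp add: n_def card_cartesian_product power2_eq_square)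
  qed
  have "(q - real (card (f ` E))) * m\<^sup>2 = (\<Sum>t\<in>F - f ` E. (q * n t - m)\<^sup>2)"
  proof -
    have "(\<Sum>t\<in>F - f ` E. (q * n t - m)\<^sup>2) = (\<Sum>t\<in>F - f ` E. m\<^sup>2)"
    proof (rule sum.cong)
      fix t assume "t \<in> F - f ` E"
      then have "{x \<in> E. f x = t} = {}" by auto
      then have "n t = 0" unfolding n_def by (metis card.empty of_nat_0)
      then show "(q * n t - m)\<^sup>2 = m\<^sup>2" by simp
    qed simp
    moreover have "real (card (F - f ` E)) = q - real (card (f ` E))"
      unfolding q_def using card_Diff_subset[OF finite_imageI[OF E] f] card_mono[OF F(1) f] by simp
    ultimately show ?thesis by simp
  qed
  also have "\<dots> \<le> (\<Sum>t\<in>F. (q * n t - m)\<^sup>2)"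
    using F(1) by (intro sum_mono2) auto
  also have "\<dots> = (\<Sum>t\<in>F. q\<^sup>2 * (n t)\<^sup>2 - 2 * q * m * n t + m\<^sup>2)"
    by (intro sum.cong refl) (simp add: power2_diff power_mult_distrib)
  also have "\<dots> = q\<^sup>2 * (\<Sum>t\<in>F. (n t)\<^sup>2) - 2 * q * m * (\<Sum>t\<in>F. n t) + q * m\<^sup>2"
    unfolding sum.distrib sum_subtractf sum_distrib_left[symmetric] by (simp add: q_def)
  also have "\<dots> = q\<^sup>2 * real (card {(x, x') \<in> E \<times> E. f x = f x'}) - q * m\<^sup>2"
    unfolding sum1 sum2 by (simp add: power2_eq_square)
  finally show ?thesis by (simp add: q_def m_def)
qed

context field
begin

text \<open>
  Exchanging the order of counting turns the sum into one over pairs \<open>(x, x')\<close> of the number of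
  pins equidistant from both: at most \<open>q\<^sup>d\<^sup>-\<^sup>1\<close> off the diagonal and all \<open>q\<^sup>d\<close> on it. The factor
  \<open>q\<close> on the left avoids the exponent \<open>d - 1\<close>.
\<close>

lemma sum_equidistant_pairs_le:
  assumes Q: "nondegenerate_quadratic_form R d Q" and fin: "finite (carrier R)"
    and E: "E \<subseteq> vecs R d"
  defines "q \<equiv> real (card (carrier R))" and "m \<equiv> real (card E)"
  shows "q * (\<Sum>y\<in>vecs R d. real (card {(x, x') \<in> E \<times> E.
               Q (vec_diff R d x y) = Q (vec_diff R d x' y)}))
         \<le> q ^ d * (q * m + m\<^sup>2)"
proof -
  have finv: "finite (vecs R d)" and cardv: "real (card (vecs R d)) = q ^ d"
    using fin by (auto simp: vecs_def card_PiE q_def intro: finite_PiE)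
  have finE: "finite E" using E finv finite_subset by blast
  have q: "q > 0"
    using fin by (auto simp: q_def card_gt_0_iff)
  define N where "N x x' = card {y \<in> vecs R d. Q (vec_diff R d x y) = Q (vec_diff R d x' y)}" for x x'
  have N: "q * real (N x x') \<le> q ^ d + (if x = x' then q * q ^ d else 0)"
    if "x \<in> E" "x' \<in> E" for x x'
  proof (cases "x = x'")
    case True
    then show ?thesis using q cardv by (simp add: N_def)
  next
    case False
    have "N x x' * card (carrier R) \<le> card (vecs R d)"
      unfolding N_def using card_equidistant_le[OF Q fin] that E False by blast
    then have "real (N x x') * q \<le> q ^ d"
      unfolding q_def cardv[symmetric, unfolded q_def] by (simp flip: of_nat_mult)
    then show ?thesis using False by (simp add: mult.commute)
  qed
  have "(\<Sum>y\<in>vecs R d. card {(x, x') \<in> E \<times> E. Q (vec_diff R d x y) = Q (vec_diff R d x' y)})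
        = (\<Sum>(x, x')\<in>E \<times> E. N x x')"
  proof -
    have "{(x, x') \<in> E \<times> E. Q (vec_diff R d x y) = Q (vec_diff R d x' y)} =
          {p \<in> E \<times> E. Q (vec_diff R d (fst p) y) = Q (vec_diff R d (snd p) y)}" for y
      by auto
    then show ?thesis
      using finv finE
      by (simp only:, intro sum_multicount_gen) (auto simp: N_def)
  qed
  then have "q * (\<Sum>y\<in>vecs R d. real (card {(x, x') \<in> E \<times> E.
               Q (vec_diff R d x y) = Q (vec_diff R d x' y)}))
        = q * real (\<Sum>(x, x')\<in>E \<times> E. N x x')"
    by (simp only: of_nat_sum[symmetric])
  also have "\<dots> = (\<Sum>x\<in>E. \<Sum>x'\<in>E. q * real (N x x'))"
    by (simp add: sum.cartesian_product sum_distrib_left case_prod_unfold)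
  also have "\<dots> \<le> (\<Sum>x\<in>E. \<Sum>x'\<in>E. q ^ d + (if x = x' then q * q ^ d else 0))"
    using N by (intro sum_mono) auto
  also have "\<dots> = q ^ d * (q * m + m\<^sup>2)"
    using finE by (simp add: sum.distrib m_def power2_eq_square algebra_simps)
  finally show ?thesis .
qed

text \<open>
  Summing the variance bound over all pins, the main term \<open>q\<^sup>d\<^sup>+\<^sup>1 m\<^sup>2\<close> of the pair count
  cancels against the squared means, and the diagonal pairs alone are left.
\<close>

lemma sum_missing_distances_le:
  assumes Q: "nondegenerate_quadratic_form R d Q" and fin: "finite (carrier R)"
    and E: "E \<subseteq> vecs R d"
  defines "q \<equiv> real (card (carrier R))" and "m \<equiv> real (card E)"
  shows "(\<Sum>y\<in>vecs R d. q - real (card (pinned_distance_set R d Q E y))) * m\<^sup>2 \<le> q ^ (d + 2) * m"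
proof -
  have qf: "quadratic_form R d Q"
    using Q by (simp add: nondegenerate_quadratic_form_def)
  have finv: "finite (vecs R d)" and cardv: "real (card (vecs R d)) = q ^ d"
    using fin by (auto simp: vecs_def card_PiE q_def intro: finite_PiE)
  have finE: "finite E" using E finv finite_subset by blast
  have q: "q > 0"
    using fin by (auto simp: q_def card_gt_0_iff)
  let ?N = "\<lambda>y. real (card {(x, x') \<in> E \<times> E. Q (vec_diff R d x y) = Q (vec_diff R d x' y)})"
  have "(q - real (card (pinned_distance_set R d Q E y))) * m\<^sup>2 \<le> q\<^sup>2 * ?N y - q * m\<^sup>2"
    if y: "y \<in> vecs R d" for y
  proof -
    have image: "pinned_distance_set R d Q E y = (\<lambda>x. Q (vec_diff R d x y)) ` E"
      by (auto simp: pinned_distance_set_def)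
    have "carrier R \<noteq> {}" by auto
    from missing_values_le[OF finE fin this, of "\<lambda>x. Q (vec_diff R d x y)"] show ?thesis
      using pinned_distance_set_subset[OF qf E y] unfolding image q_def m_def by simp
  qed
  then have "(\<Sum>y\<in>vecs R d. (q - real (card (pinned_distance_set R d Q E y))) * m\<^sup>2)
             \<le> (\<Sum>y\<in>vecs R d. q\<^sup>2 * ?N y - q * m\<^sup>2)"
    by (rule sum_mono)
  then have "(\<Sum>y\<in>vecs R d. q - real (card (pinned_distance_set R d Q E y))) * m\<^sup>2
             \<le> q * (q * (\<Sum>y\<in>vecs R d. ?N y)) - q ^ d * (q * m\<^sup>2)"
    by (simp add: sum_subtractf cardv power2_eq_square
        flip: sum_distrib_left sum_distrib_right mult.assoc)
  also have "\<dots> \<le> q * (q ^ d * (q * m + m\<^sup>2)) - q ^ d * (q * m\<^sup>2)"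
    using sum_equidistant_pairs_le[OF Q fin E] q
    by (intro diff_right_mono mult_left_mono) (auto simp: q_def m_def)
  also have "\<dots> = q ^ (d + 2) * m"
    by (simp add: power_add power2_eq_square algebra_simps)
  finally show ?thesis .
qed

text \<open>
  Markov's inequality. The threshold \<open>\<delta>\<close> is chosen with \<open>(\<delta> m)\<^sup>2 = q\<^sup>d\<^sup>+\<^sup>1\<close>, which makes
  the bound on the proportion of bad pins equal to the proportion \<open>\<delta>\<close> of missing distances that
  defines them.
\<close>

lemma card_bad_pins_le:
  assumes Q: "nondegenerate_quadratic_form R d Q" and fin: "finite (carrier R)"
    and E: "E \<subseteq> vecs R d"
  defines "q \<equiv> real (card (carrier R))" and "m \<equiv> real (card E)"
  defines "\<delta> \<equiv> q powr ((real d + 1) / 2) / m"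
  shows "real (card {y \<in> E. q - real (card (pinned_distance_set R d Q E y)) > \<delta> * q}) \<le> \<delta> * m"
proof (cases "E = {}")
  case True
  then show ?thesis by (simp add: m_def)
next
  case False
  have qf: "quadratic_form R d Q"
    using Q by (simp add: nondegenerate_quadratic_form_def)
  have finv: "finite (vecs R d)"
    using fin by (auto simp: vecs_def intro: finite_PiE)
  have finE: "finite E" using E finv finite_subset by blast
  have q: "q > 0"
    using fin by (auto simp: q_def card_gt_0_iff)
  have m: "m > 0"
    using False finE by (simp add: m_def card_gt_0_iff)
  have \<delta>: "\<delta> > 0" using q m by (simp add: \<delta>_def)
  have \<delta>2: "(\<delta> * m)\<^sup>2 = q ^ (d + 1)"
  proof -
    have "(\<delta> * m)\<^sup>2 = (q powr ((real d + 1) / 2))\<^sup>2"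
      using m by (simp add: \<delta>_def)
    also have "\<dots> = q powr (real (d + 1))"
      by (simp add: power2_eq_square powr_add[symmetric] add.commute)
    also have "\<dots> = q ^ (d + 1)"
      using q by (rule powr_realpow)
    finally show ?thesis .
  qed
  let ?\<Delta> = "\<lambda>y. real (card (pinned_distance_set R d Q E y))"
  let ?B = "{y \<in> E. q - ?\<Delta> y > \<delta> * q}"
  have nonneg: "q - ?\<Delta> y \<ge> 0" if "y \<in> vecs R d" for y
  proof -
    have "pinned_distance_set R d Q E y \<subseteq> carrier R"
      using pinned_distance_set_subset[OF qf E that] .
    then show ?thesis using card_mono[OF fin] by (simp add: q_def)
  qed
  have "real (card ?B) * (\<delta> * q) = (\<Sum>y\<in>?B. \<delta> * q)"
    by simp
  also have "\<dots> \<le> (\<Sum>y\<in>?B. q - ?\<Delta> y)"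
    by (intro sum_mono) auto
  also have "\<dots> \<le> (\<Sum>y\<in>vecs R d. q - ?\<Delta> y)"
    using finv E nonneg by (intro sum_mono2) auto
  finally have "real (card ?B) * (\<delta> * q) * m\<^sup>2 \<le> (\<Sum>y\<in>vecs R d. q - ?\<Delta> y) * m\<^sup>2"
    by (intro mult_right_mono) auto
  also have "\<dots> \<le> q ^ (d + 2) * m"
    using sum_missing_distances_le[OF Q fin E] by (simp add: q_def m_def)
  also have "\<dots> = q * (\<delta> * m)\<^sup>2 * m"
    unfolding \<delta>2 by simp
  also have "\<dots> = \<delta> * m * (\<delta> * q * m\<^sup>2)"
    by (simp add: power2_eq_square mult_ac)
  finally have "real (card ?B) * (\<delta> * q * m\<^sup>2) \<le> \<delta> * m * (\<delta> * q * m\<^sup>2)"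
    by (simp only: mult.assoc)
  moreover have "\<delta> * q * m\<^sup>2 > 0"
    using \<delta> q m by (intro mult_pos_pos) auto
  ultimately show ?thesis
    by (rule mult_right_le_imp_le)
qed

end

section \<open>Almost every pin sees almost every distance\<close>

theorem theorem2p24:
  fixes d :: nat
    and R :: "nat \<Rightarrow> ('a, 'm) ring_scheme"
    and q :: "nat \<Rightarrow> nat"
    and Q :: "nat \<Rightarrow> (nat \<Rightarrow> 'a) \<Rightarrow> 'a"
    and E :: "nat \<Rightarrow> (nat \<Rightarrow> 'a) set"
  assumes "d \<ge> 2"
    and "\<And>n. field (R n)"
    and "\<And>n. finite (carrier (R n))"
    and "\<And>n. card (carrier (R n)) = q n"
    and "\<And>n. \<exists>p k. prime p \<and> odd p \<and> k \<ge> 1 \<and> q n = p ^ k"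
    and "filterlim q at_top sequentially"
    and "\<And>n. nondegenerate_quadratic_form (R n) d (Q n)"
    and "\<And>n. E n \<subseteq> vecs (R n) d"
    and "(\<lambda>n. real (q n) powr ((real d + 1) / 2)) \<in> o(\<lambda>n. real (card (E n)))"
  shows "\<exists>(E' :: nat \<Rightarrow> (nat \<Rightarrow> 'a) set) (\<epsilon> :: nat \<Rightarrow> real) (\<delta> :: nat \<Rightarrow> real).
           \<epsilon> \<longlonglongrightarrow> 0 \<and> \<delta> \<longlonglongrightarrow> 0 \<and>
           (\<forall>n. E' n \<subseteq> E n \<and>
                real (card (E' n)) = (1 - \<epsilon> n) * real (card (E n)) \<and>
                (\<forall>y\<in>E' n.
                   \<bar>real (card (pinned_distance_set (R n) d (Q n) (E n) y)) - real (q n)\<bar>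
                     \<le> \<delta> n * real (q n)))"
proof -
  define \<Delta> where "\<Delta> n y = real (card (pinned_distance_set (R n) d (Q n) (E n) y))" for n y
  define \<delta> where "\<delta> n = real (q n) powr ((real d + 1) / 2) / real (card (E n))" for n
  define B where "B n = {y \<in> E n. real (q n) - \<Delta> n y > \<delta> n * real (q n)}" for n
  \<comment> \<open>If \<open>E n\<close> is empty, \<open>\<delta> n\<close> and \<open>\<epsilon> n\<close> are quotients by zero, hence \<open>0\<close>, and no pin has to
     be considered.\<close>
  define \<epsilon> where "\<epsilon> n = real (card (B n)) / real (card (E n))" for n
  have finE: "finite (E n)" for n
  proof -
    have "finite (vecs (R n) d)"
      unfolding vecs_def using assms(3) by (auto intro: finite_PiE)
    then show ?thesis using assms(8) finite_subset by blast
  qed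
  have \<delta>: "\<delta> \<longlonglongrightarrow> 0"
    using smalloD_tendsto[OF assms(9)] by (simp add: \<delta>_def[abs_def])
  have bad: "real (card (B n)) \<le> \<delta> n * real (card (E n))" for n
    using field.card_bad_pins_le[OF assms(2) assms(7) assms(3) assms(8), of n]
    by (simp add: B_def \<Delta>_def \<delta>_def assms(4))
  have "\<epsilon> n \<le> \<delta> n" for n
    using bad[of n] by (cases "card (E n) = 0") (simp_all add: \<epsilon>_def \<delta>_def field_simps)
  then have \<epsilon>: "\<epsilon> \<longlonglongrightarrow> 0"
    by (intro tendsto_sandwich[OF _ _ tendsto_const \<delta>]) (auto simp: \<epsilon>_def)
  have card: "real (card (E n - B n)) = (1 - \<epsilon> n) * real (card (E n))" for n
  proof -
    have sub: "B n \<subseteq> E n" by (auto simp: B_def)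
    have "real (card (E n - B n)) = real (card (E n)) - real (card (B n))"
      using finE[of n] sub by (simp add: card_Diff_subset finite_subset card_mono of_nat_diff)
    also have "\<dots> = (1 - \<epsilon> n) * real (card (E n))"
      using card_mono[OF finE sub] by (cases "card (E n) = 0") (auto simp: \<epsilon>_def field_simps)
    finally show ?thesis .
  qed
  have dist: "\<bar>\<Delta> n y - real (q n)\<bar> \<le> \<delta> n * real (q n)" if "y \<in> E n - B n" for n y
  proof -
    interpret field "R n" by (rule assms(2))
    have "quadratic_form (R n) d (Q n)"
      using assms(7)[of n] by (simp add: nondegenerate_quadratic_form_def)
    then have "pinned_distance_set (R n) d (Q n) (E n) y \<subseteq> carrier (R n)"
      using that assms(8)[of n] by (intro pinned_distance_set_subset) auto
    then have "\<Delta> n y \<le> real (q n)"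
      using card_mono[OF assms(3)[of n]] by (simp add: \<Delta>_def assms(4))
    with that show ?thesis by (auto simp: B_def)
  qed
  show ?thesis
    using \<epsilon> \<delta> card dist unfolding \<Delta>_def
    by (intro exI[of _ "\<lambda>n. E n - B n"] exI[of _ \<epsilon>] exI[of _ \<delta>]) auto
qed

end
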